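(* Let $q$ be a prime power, $n$ a positive integer, and $m,m',s$ nonnegative integers. Let $\boldsymbol{b}'=\boldsymbol{b}T$, where $\boldsymbol{b}=(b_1,\ldots,b_m)$, $\boldsymbol{b}'=(b'_1,\ldots,b'_{m'})$, $b_i,b'_i\in\mathbb{F}_q^n$, and $T$ is an $m\times m'$ matrix over $\mathbb{F}_q$. Denote $B=\{\!\{b_1,\ldots,b_m\}\!\}$ and $B'=\{\!\{b'_1,\ldots,b'_{m'}\}\!\}$. (1) If $m'=m-s$ and $\operatorname{rank}T=m'$, then $d(\operatorname{mspan}_q(B),\operatorname{mspan}_q(B'))=s$. (2) If $m'=m$ and $\operatorname{rank}T=m-s$, then $d(\operatorname{mspan}_q(B),\operatorname{mspan}_q(B'))\leqslant 2s$.
   Context: A multiset $M$ over a universe $U$ is given by a multiplicity function $\mu_M\colon U\to\{0,1,2,\ldots\}$; its size is $|M|=\sum_{a\in U}\mu_M(a)$, and $M_1\subseteq M_2$ means $\mu_{M_1}\leqslant\mu_{M_2}$ pointwise. For a finite multiset $B=\{\!\{b_1,\ldots,b_m\}\!\}$ over $\mathbb{F}_q^n$ (the $b_i$ are not necessarily distinct), the multispan $\operatorname{mspan}_q(B)$ is the multiset over $\mathbb{F}_q^n$ in which the multiplicity of $v$ is the number of $m$-tuples $(\alpha_1,\ldots,\alpha_m)\in\mathbb{F}_q^m$ with $\sum_{i=1}^m\alpha_i b_i=v$; if $B$ is empty, $\operatorname{mspan}_q(B)=\{0\}$ (with $0$ of multiplicity $1$). A multiset $W$ over $\mathbb{F}_q^n$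 is a multispace over $\mathbb{F}_q^n$ if $W=\operatorname{mspan}_q(B)$ for some multiset $B$; then $\operatorname{rank}(W)=|B|=\log_q|W|$. Let $\mathcal{M}_q(n)$ be the collection of all multispaces over $\mathbb{F}_q^n$. The poset $(\mathcal{M}_q(n),\subseteq)$ is a lattice with meet $\land$ and join $\lor$; the meet $W_1\land W_2$ is the multiset intersection (with multiplicity function $\min\{\mu_{W_1},\mu_{W_2}\}$). The metric $d$ on $\mathcal{M}_q(n)$ is $$d(W_1,W_2)=\operatorname{rank}(W_1\lor W_2)-\operatorname{rank}(W_1\land W_2)=\operatorname{rank}(W_1)+\operatorname{rank}(W_2)-2\operatorname{rank}(W_1\land W_2).$$ The product $\boldsymbol{b}T$ is the row-vector-times-matrix product: $b'_j=\sum_{i=1}^m T_{ij}b_i$. *)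

theory Defs
  imports
    "HOL-Analysis.Finite_Cartesian_Product"
    "HOL-Library.Multiset"
    "HOL-Algebra.Lattice"
    "Jordan_Normal_Form.DL_Rank"
begin

text \<open>
  The field \<open>\<bbbF>\<^sub>q\<close> is a type \<open>'a :: {field, finite}\<close> with \<open>q = CARD('a)\<close>, and
  \<open>\<bbbF>\<^sub>q\<^sup>n\<close> is \<open>'a ^ 'n\<close> with \<open>n = CARD('n)\<close>. Tuples of vectors are lists, indexed from 0.
\<close>

definition tuple_lincomb :: "'a::field list \<Rightarrow> ('a ^ 'n) list \<Rightarrow> 'a ^ 'n" where
  "tuple_lincomb \<alpha> b = (\<Sum>i<length b. \<alpha> ! i *s b ! i)"

definition mspan_list :: "('a::{field,finite} ^ 'n) list \<Rightarrow> ('a ^ 'n) multiset" where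
  "mspan_list b = image_mset (\<lambda>\<alpha>. tuple_lincomb \<alpha> b) (mset_set {\<alpha>. length \<alpha> = length b})"

text \<open>The choice of the enumeration is irrelevant, see \<open>mspan_mset\<close> below.\<close>

definition mspan :: "('a::{field,finite} ^ 'n) multiset \<Rightarrow> ('a ^ 'n) multiset" where
  "mspan B = mspan_list (SOME b. mset b = B)"

definition multispaces :: "('a::{field,finite} ^ 'n) multiset set" where
  "multispaces = range mspan"

text \<open>On multispaces this is well defined, see \<open>multispace_rank_mspan\<close> below.\<close>

definition multispace_rank :: "('a::{field,finite} ^ 'n) multiset \<Rightarrow> nat" where
  "multispace_rank W = (THE r. \<exists>B. W = mspan B \<and> r = size B)"

definition multispace_poset :: "('a::{field,finite} ^ 'n) multiset gorder" where
  "multispace_poset = \<lparr>carrier = multispaces, eq = (=), le = (\<subseteq>#)\<rparr>"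

text \<open>
  Join and meet are the least upper and greatest lower bound within the poset of multispaces
  (the union of two multispaces is in general not a multispace). The value is an integer so
  that the subtraction is not truncated.
\<close>

definition multispace_dist ::
    "('a::{field,finite} ^ 'n) multiset \<Rightarrow> ('a ^ 'n) multiset \<Rightarrow> int" where
  "multispace_dist W\<^sub>1 W\<^sub>2 =
     int (multispace_rank (W\<^sub>1 \<squnion>\<^bsub>multispace_poset\<^esub> W\<^sub>2))
     - int (multispace_rank (W\<^sub>1 \<sqinter>\<^bsub>multispace_poset\<^esub> W\<^sub>2))"

definition row_times_mat :: "('a::field ^ 'n) list \<Rightarrow> 'a mat \<Rightarrow> ('a ^ 'n) list" where
  "row_times_mat b T =
     map (\<lambda>j. \<Sum>i<length b. T $$ (i, j) *s b ! i) [0..<dim_col T]"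

text \<open>\<open>vec_space.rank m\<close> is the dimension of the column space, a subspace of \<open>\<bbbF>\<^sub>q\<^sup>m\<close>.\<close>

abbreviation mat_rank :: "'a::field mat \<Rightarrow> nat" where
  "mat_rank T \<equiv> vec_space.rank (dim_row T) T"


lemma finite_tuples: "finite {\<alpha> :: 'a::finite list. length \<alpha> = k}"
  using finite_lists_length_eq[of "UNIV :: 'a set" k] by simp

lemma count_mspan_list:
  "count (mspan_list b) v = card {\<alpha>. length \<alpha> = length b \<and> tuple_lincomb \<alpha> b = v}"
proof -
  have "{\<alpha>. length \<alpha> = length b} \<inter> (\<lambda>\<alpha>. tuple_lincomb \<alpha> b) -` {v}
      = {\<alpha>. length \<alpha> = length b \<and> tuple_lincomb \<alpha> b = v}"
    by auto
  then show ?thesis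
    unfolding mspan_list_def count_image_mset
    by (simp add: finite_tuples Int_commute)
qed

lemma mspan_list_cong_mset:
  fixes b c :: "('a::{field,finite} ^ 'n) list"
  assumes "mset b = mset c"
  shows "mspan_list b = mspan_list c"
proof -
  have len: "length b = length c"
    using assms by (metis size_mset)
  obtain p where p: "p permutes {..<length c}" and pb: "permute_list p c = b"
    using mset_eq_permutation[OF assms] by auto
  let ?A = "{\<alpha> :: 'a list. length \<alpha> = length c}"
  have inj: "inj_on (permute_list p) ?A"
  proof (rule inj_onI)
    fix x y :: "'a list"
    assume x: "x \<in> ?A" and y: "y \<in> ?A" and eq: "permute_list p x = permute_list p y"
    have "x ! p i = y ! p i" if "i < length c" for i
      using x y p that eq permute_list_nth[of p x i] permute_list_nth[of p y i] by simp
    moreover have "\<exists>i<length c. p i = j" if "j < length c" for j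
      using permutes_image[OF p] that by (metis imageE lessThan_iff)
    ultimately show "x = y"
      using x y by (metis (mono_tags, lifting) mem_Collect_eq nth_equalityI)
  qed
  have im: "permute_list p ` ?A = ?A"
    by (rule card_subset_eq) (auto simp: finite_tuples card_image[OF inj])
  have lin: "tuple_lincomb (permute_list p \<alpha>) b = tuple_lincomb \<alpha> c" if "\<alpha> \<in> ?A" for \<alpha>
  proof -
    have "tuple_lincomb (permute_list p \<alpha>) b = (\<Sum>i<length c. \<alpha> ! p i *s c ! p i)"
      unfolding tuple_lincomb_def len
      using that p by (intro sum.cong) (auto simp: pb[symmetric] permute_list_nth)
    also have "\<dots> = (\<Sum>i<length c. \<alpha> ! i *s c ! i)"
      using sum.permute[OF p, of "\<lambda>i. \<alpha> ! i *s c ! i"] by (simp add: o_def)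
    finally show ?thesis
      by (simp add: tuple_lincomb_def)
  qed
  have "mspan_list b = image_mset (\<lambda>\<alpha>. tuple_lincomb \<alpha> b) (mset_set (permute_list p ` ?A))"
    by (simp add: mspan_list_def len im)
  also have "\<dots> = image_mset (\<lambda>\<alpha>. tuple_lincomb (permute_list p \<alpha>) b) (mset_set ?A)"
    by (simp add: image_mset_mset_set[OF inj, symmetric] multiset.map_comp o_def)
  also have "\<dots> = mspan_list c"
    unfolding mspan_list_def using lin by (intro image_mset_cong) (auto simp: finite_tuples)
  finally show ?thesis .
qed

lemma mspan_mset: "mspan (mset b) = mspan_list b"
  unfolding mspan_def by (rule mspan_list_cong_mset, rule someI) (rule refl)

lemma mspan_empty: "mspan {#} = {#0#}"
  using mspan_mset[of "[]"] by (simp add: mspan_list_def tuple_lincomb_def)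

lemma size_mspan:
  fixes B :: "('a::{field,finite} ^ 'n) multiset"
  shows "size (mspan B) = CARD('a) ^ size B"
proof -
  obtain b where "mset b = B"
    using ex_mset by blast
  then show ?thesis
    using card_lists_length_eq[of "UNIV :: 'a set" "length b"]
    by (auto simp: mspan_mset mspan_list_def simp flip: \<open>mset b = B\<close>)
qed

lemma multispace_rank_mspan:
  fixes B :: "('a::{field,finite} ^ 'n) multiset"
  shows "multispace_rank (mspan B) = size B"
proof -
  have "card {0, 1 :: 'a} \<le> CARD('a)"
    by (rule card_mono) simp_all
  then have q: "1 < CARD('a)"
    by simp
  have eq: "size C = size B" if "mspan B = mspan C" for C :: "('a ^ 'n) multiset"
    using that size_mspan[of B] size_mspan[of C] power_inject_exp[OF q] by metis
  show ?thesis
    unfolding multispace_rank_def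
  proof (rule the_equality)
    show "\<exists>C. mspan B = mspan C \<and> size B = size C"
      by (rule exI[of _ B]) simp
  next
    fix r
    assume "\<exists>C. mspan B = mspan C \<and> r = size C"
    then obtain C where "mspan B = mspan C" "r = size C"
      by (elim exE conjE)
    then show "r = size B"
      using eq[of C] by simp
  qed
qed

end

theory Submission
  imports Defs "HOL-Analysis.Cartesian_Space"
begin

text \<open>
  If \<open>T\<close> has linearly independent columns, then \<open>\<alpha> \<mapsto> T \<alpha>\<close> is injective and turns every
  representation of \<open>v\<close> over \<open>b T\<close> into one over \<open>b\<close>, so the multispan of \<open>b T\<close> is contained in
  that of \<open>b\<close>. This gives (1), since the distance of comparable multispaces is the difference of
  their ranks. For (2), split \<open>b T\<close> into a part \<open>c\<close> coming from \<open>rank T = m - s\<close> independent columns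
  and a rest \<open>d\<close> of length \<open>s\<close>: the multispan of \<open>c\<close> lies below both multispaces, and the multispan
  of \<open>b\<close> together with \<open>d\<close> lies above both, so the ranks of meet and join are at least \<open>m - s\<close>
  and at most \<open>m + s\<close>. Meets and joins exist because a multispace amounts to a pair \<open>(V, k)\<close> of a
  subspace and an exponent, every element of \<open>V\<close> having multiplicity \<open>q\<^sup>k\<close>.
\<close>

section \<open>Multiplicities in a multispan\<close>

lemma tuple_lincomb_Cons:
  "tuple_lincomb (c # \<alpha>) (a # b) = c *s a + tuple_lincomb \<alpha> b"
  unfolding tuple_lincomb_def by (simp add: sum.lessThan_Suc_shift del: sum.lessThan_Suc)

text \<open>The tuples are sorted by their first coefficient \<open>c\<close>; the other
  coefficients then have to represent \<open>v - c *s a\<close>.\<close>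

lemma count_mspan_list_Cons:
  fixes a :: "'a::{field,finite} ^ 'n"
  shows "count (mspan_list (a # b)) v = (\<Sum>c\<in>UNIV. count (mspan_list b) (v - c *s a))"
proof -
  let ?S = "\<lambda>c. {\<alpha>. length \<alpha> = length b \<and> tuple_lincomb \<alpha> b = v - c *s a}"
  have "{\<alpha>. length \<alpha> = length (a # b) \<and> tuple_lincomb \<alpha> (a # b) = v}
      = (\<Union>c\<in>UNIV. (#) c ` ?S c)"
  proof (rule Set.set_eqI)
    fix \<alpha> :: "'a list"
    show "\<alpha> \<in> {\<alpha>. length \<alpha> = length (a # b) \<and> tuple_lincomb \<alpha> (a # b) = v}
      \<longleftrightarrow> \<alpha> \<in> (\<Union>c\<in>UNIV. (#) c ` ?S c)"
      by (cases \<alpha>) (auto simp: tuple_lincomb_Cons eq_diff_eq add.commute)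
  qed
  moreover have "card (\<Union>c\<in>UNIV. (#) c ` ?S c) = (\<Sum>c\<in>UNIV. card ((#) c ` ?S c))"
    by (intro card_UN_disjoint) (auto intro: finite_subset[OF _ finite_tuples])
  moreover have "card ((#) c ` ?S c) = card (?S c)" for c
    by (rule card_image) simp
  ultimately show ?thesis
    by (simp add: count_mspan_list)
qed

text \<open>Rank-nullity over a finite field: the tuples representing \<open>v\<close> are either
  none or a coset of the space of linear relations, whose dimension is
  \<open>length b - vec.dim (set b)\<close>.\<close>

lemma count_mspan_list_span:
  fixes b :: "('a::{field,finite} ^ 'n) list"
  shows "count (mspan_list b) v =
    (if v \<in> vec.span (set b) then CARD('a) ^ (length b - vec.dim (set b)) else 0)"
proof (induction b arbitrary: v)
  case Nil
  then show ?case
    by (auto simp: count_mspan_list tuple_lincomb_def vec.dim_empty)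
next
  case (Cons a b)
  \<comment> \<open>This makes the truncated subtraction exact, so that the exponent grows by one
    when the length grows and the dimension does not.\<close>
  have le: "vec.dim (set b) \<le> length b"
    using vec.dim_le_card'[of "set b"] card_length[of b] by simp
  let ?I = "{c. v - c *s a \<in> vec.span (set b)}"
  let ?q = "CARD('a) ^ (length b - vec.dim (set b))"
  have cnt: "count (mspan_list (a # b)) v = card ?I * ?q"
    by (simp add: count_mspan_list_Cons Cons.IH sum.If_cases)
  show ?case
  proof (cases "a \<in> vec.span (set b)")
    case True
    \<comment> \<open>Either every coefficient \<open>c\<close> is admissible or none is, so the
      multiplicity gains a factor \<open>q\<close>.\<close>
    then have "v - c *s a \<in> vec.span (set b) \<longleftrightarrow> v \<in> vec.span (set b)" for c
      by (metis diff_add_cancel vec.span_add vec.span_diff vec.span_scale)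
    moreover have "vec.span (insert a (set b)) = vec.span (set b)"
      using True by (rule vec.span_redundant)
    ultimately show ?thesis
      using True le by (simp add: cnt vec.dim_insert Suc_diff_le)
  next
    case False
    \<comment> \<open>Two admissible coefficients would put a nonzero multiple of \<open>a\<close>,
      hence \<open>a\<close> itself, into the old span.\<close>
    have uniq: "c = c'" if c: "c \<in> ?I" and c': "c' \<in> ?I" for c c'
    proof (rule ccontr)
      assume "c \<noteq> c'"
      have "(c - c') *s a \<in> vec.span (set b)"
        using vec.span_diff[of "v - c' *s a" "set b" "v - c *s a"] c c'
        by (simp add: vec.scale_left_diff_distrib)
      then have "inverse (c - c') *s ((c - c') *s a) \<in> vec.span (set b)"
        by (rule vec.span_scale)
      then show False
        using False \<open>c \<noteq> c'\<close> by simp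
    qed
    have "card ?I = (if v \<in> vec.span (set (a # b)) then 1 else 0)"
    proof (cases "?I = {}")
      case True
      then show ?thesis by (simp add: vec.span_breakdown_eq)
    next
      case False
      then obtain c where "c \<in> ?I" by blast
      then have "?I = {c}"
        using uniq by blast
      with \<open>c \<in> ?I\<close> show ?thesis
        by (auto simp add: vec.span_breakdown_eq)
    qed
    then show ?thesis
      using False by (simp add: cnt vec.dim_insert)
  qed
qed

section \<open>Multispaces as subspaces with an exponent, and their lattice\<close>

lemma multispaces_iff:
  fixes W :: "('a::{field,finite} ^ 'n) multiset"
  shows "W \<in> multispaces \<longleftrightarrow>
    (\<exists>V k. vec.subspace V \<and> (\<forall>v. count W v = (if v \<in> V then CARD('a) ^ k else 0)))"
    (is "_ \<longleftrightarrow> ?R")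
proof
  assume "W \<in> multispaces"
  then obtain b where "W = mspan_list b"
    unfolding multispaces_def by (metis ex_mset imageE mspan_mset)
  then show ?R
    using vec.subspace_span count_mspan_list_span by blast
next
  assume ?R
  then obtain V k where V: "vec.subspace V"
    and W: "\<And>v. count W v = (if v \<in> V then CARD('a) ^ k else 0)"
    by auto
  obtain B where B: "B \<subseteq> V" "vec.independent B" "V \<subseteq> vec.span B" "card B = vec.dim V"
    using vec.basis_exists[of V] .
  have sp: "vec.span B = V"
    using B V by (simp add: vec.span_subspace)
  obtain bs where bs: "set bs = B" "distinct bs"
    using finite_distinct_list[of B] by auto
  \<comment> \<open>each additional zero vector multiplies all multiplicities by \<open>q\<close>\<close>
  let ?b = "replicate k 0 @ bs"
  have "vec.span (set ?b) = V"
    using sp bs by (cases "k = 0") (auto simp: vec.span_insert_0)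
  moreover have "length ?b - vec.dim (set ?b) = k"
  proof -
    have "vec.dim (set ?b) = vec.dim V"
      using \<open>vec.span (set ?b) = V\<close> by (metis vec.dim_span)
    then show ?thesis
      using B bs distinct_card[of bs] by simp
  qed
  ultimately have "W = mspan_list ?b"
    using W by (intro multiset_eqI) (simp add: count_mspan_list_span)
  then show "W \<in> multispaces"
    unfolding multispaces_def by (simp add: mspan_mset[symmetric])
qed

lemma card_field_gt_1: "1 < CARD('a::{field,finite})"
proof -
  have "card {0, 1 :: 'a} \<le> CARD('a)"
    by (rule card_mono) simp_all
  then show ?thesis by simp
qed

text \<open>Powers of \<open>q\<close> are nonzero, which compares the supports, and
  \<open>q > 1\<close> compares the exponents. As 0 lies in \<open>V\<close>, there is a vector at
  which the exponents get compared.\<close>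

lemma uniform_subseteq_iff:
  fixes W W' :: "('a::{field,finite} ^ 'n) multiset"
  assumes "vec.subspace V" "\<And>v. count W v = (if v \<in> V then CARD('a) ^ k else 0)"
    and "\<And>v. count W' v = (if v \<in> V' then CARD('a) ^ k' else 0)"
  shows "W \<subseteq># W' \<longleftrightarrow> V \<subseteq> V' \<and> k \<le> k'"
proof -
  have "W \<subseteq># W' \<longleftrightarrow> (\<forall>v\<in>V. v \<in> V' \<and> k \<le> k')"
    using assms(2,3) card_field_gt_1[where 'a = 'a]
    by (auto simp: subseteq_mset_def power_increasing_iff split: if_splits)
  then show ?thesis
    using vec.subspace_0[OF assms(1)] by blast
qed

lemma uniform_multispace:
  fixes V :: "('a::{field,finite} ^ 'n) set"
  assumes "vec.subspace V"
  obtains W where "W \<in> multispaces"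
    and "\<And>v. count W v = (if v \<in> V then CARD('a) ^ k else 0)"
proof -
  let ?W = "Abs_multiset (\<lambda>v. if v \<in> V then CARD('a) ^ k else 0)"
  have W: "count ?W v = (if v \<in> V then CARD('a) ^ k else 0)" for v
    by (subst count_Abs_multiset) simp_all
  have "?W \<in> multispaces"
    unfolding multispaces_iff using assms W by blast
  then show ?thesis
    using W by (rule that)
qed

text \<open>The join of \<open>(V1, k1)\<close> and \<open>(V2, k2)\<close> is the sum of the
  subspaces with the larger exponent, the meet their intersection with the smaller one. Existence
  matters because the join and meet operations are defined by choice.\<close>

lemma lattice_multispace_poset:
  "lattice (multispace_poset :: ('a::{field,finite} ^ 'n) multiset gorder)"
proof -
  let ?L = "multispace_poset :: ('a ^ 'n) multiset gorder"
  interpret partial_order ?L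
    by unfold_locales (auto simp: multispace_poset_def)
  show ?thesis
  proof (intro lattice.intro upper_semilattice.intro lower_semilattice.intro partial_order_axioms
      weak_partial_order_axioms weak_lattice.intro weak_upper_semilattice.intro
      weak_lower_semilattice.intro weak_upper_semilattice_axioms.intro
      weak_lower_semilattice_axioms.intro upper_semilattice_axioms.intro
      lower_semilattice_axioms.intro)
    fix W1 W2 :: "('a ^ 'n) multiset"
    assume "W1 \<in> carrier ?L" "W2 \<in> carrier ?L"
    then have W: "W1 \<in> multispaces" "W2 \<in> multispaces"
      by (simp_all add: multispace_poset_def)
    obtain V1 k1 where 1: "vec.subspace V1"
        "\<And>v. count W1 v = (if v \<in> V1 then CARD('a) ^ k1 else 0)"
      using W(1) unfolding multispaces_iff by auto
    obtain V2 k2 where 2: "vec.subspace V2"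
        "\<And>v. count W2 v = (if v \<in> V2 then CARD('a) ^ k2 else 0)"
      using W(2) unfolding multispaces_iff by auto
    show "\<exists>S. least ?L S (Upper ?L {W1, W2})"
    proof -
      have J: "vec.subspace (vec.span (V1 \<union> V2))"
        by (rule vec.subspace_span)
      obtain S where S: "S \<in> multispaces"
          "\<And>v. count S v = (if v \<in> vec.span (V1 \<union> V2) then CARD('a) ^ max k1 k2 else 0)"
        using uniform_multispace[OF J] by blast
      have "W1 \<subseteq># S \<and> W2 \<subseteq># S"
        using uniform_subseteq_iff[OF 1 S(2)] uniform_subseteq_iff[OF 2 S(2)]
          vec.span_superset[of "V1 \<union> V2"] by simp
      moreover have "S \<subseteq># U" if U: "U \<in> multispaces" "W1 \<subseteq># U" "W2 \<subseteq># U" for U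
      proof -
        obtain V k where 3: "vec.subspace V"
            "\<And>v. count U v = (if v \<in> V then CARD('a) ^ k else 0)"
          using U(1) unfolding multispaces_iff by auto
        have "V1 \<union> V2 \<subseteq> V" "max k1 k2 \<le> k"
          using U uniform_subseteq_iff[OF 1 3(2)] uniform_subseteq_iff[OF 2 3(2)] by auto
        then show ?thesis
          using uniform_subseteq_iff[OF J S(2) 3(2)] vec.span_minimal[OF _ 3(1)] by blast
      qed
      ultimately have "least ?L S (Upper ?L {W1, W2})"
        using S(1) W by (auto simp: least_def Upper_def multispace_poset_def)
      then show ?thesis ..
    qed
    show "\<exists>I. greatest ?L I (Lower ?L {W1, W2})"
    proof -
      have J: "vec.subspace (V1 \<inter> V2)"
        using 1 2 by (intro vec.subspace_inter)
      obtain S where S: "S \<in> multispaces"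
          "\<And>v. count S v = (if v \<in> V1 \<inter> V2 then CARD('a) ^ min k1 k2 else 0)"
        using uniform_multispace[OF J] by blast
      have "S \<subseteq># W1 \<and> S \<subseteq># W2"
        using uniform_subseteq_iff[OF J S(2) 1(2)] uniform_subseteq_iff[OF J S(2) 2(2)] by simp
      moreover have "U \<subseteq># S" if U: "U \<in> multispaces" "U \<subseteq># W1" "U \<subseteq># W2" for U
      proof -
        obtain V k where 3: "vec.subspace V"
            "\<And>v. count U v = (if v \<in> V then CARD('a) ^ k else 0)"
          using U(1) unfolding multispaces_iff by auto
        show ?thesis
          using U uniform_subseteq_iff[OF 3 1(2)] uniform_subseteq_iff[OF 3 2(2)]
            uniform_subseteq_iff[OF 3 S(2)] by simp
      qed
      ultimately have "greatest ?L S (Lower ?L {W1, W2})"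
        using S(1) W by (auto simp: greatest_def Lower_def multispace_poset_def)
      then show ?thesis ..
    qed
  qed
qed

section \<open>Bounds on the distance\<close>

lemma mspan_subseteq_size:
  fixes B C :: "('a::{field,finite} ^ 'n) multiset"
  assumes "mspan B \<subseteq># mspan C"
  shows "size B \<le> size C"
  using size_mset_mono[OF assms] card_field_gt_1[where 'a = 'a]
  by (simp add: size_mspan power_increasing_iff)

text \<open>The join lies below any common upper bound, the meet above any common lower bound, and
  rank is monotone.\<close>

lemma multispace_dist_le:
  fixes A B C D :: "('a::{field,finite} ^ 'n) multiset"
  assumes "mspan C \<subseteq># mspan A" "mspan C \<subseteq># mspan B"
    and "mspan A \<subseteq># mspan D" "mspan B \<subseteq># mspan D"
  shows "multispace_dist (mspan A) (mspan B) \<le> int (size D) - int (size C)"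
proof -
  let ?L = "multispace_poset :: ('a ^ 'n) multiset gorder"
  interpret lattice ?L
    by (rule lattice_multispace_poset)
  have car: "carrier ?L = range mspan" and le: "le ?L = (\<subseteq>#)"
    by (simp_all add: multispace_poset_def multispaces_def)
  have "mspan A \<squnion>\<^bsub>?L\<^esub> mspan B \<in> range mspan" "mspan A \<sqinter>\<^bsub>?L\<^esub> mspan B \<in> range mspan"
    using join_closed[of "mspan A" "mspan B"] meet_closed[of "mspan A" "mspan B"]
    by (simp_all add: car)
  then obtain J M where J: "mspan A \<squnion>\<^bsub>?L\<^esub> mspan B = mspan J"
    and M: "mspan A \<sqinter>\<^bsub>?L\<^esub> mspan B = mspan M"
    by auto
  have "mspan J \<subseteq># mspan D"
    using join_le[of "mspan A" "mspan D" "mspan B"] assms by (simp add: car le J)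
  moreover have "mspan C \<subseteq># mspan M"
    using meet_le[of "mspan C" "mspan A" "mspan B"] assms by (simp add: car le M)
  ultimately show ?thesis
    using mspan_subseteq_size[of J D] mspan_subseteq_size[of C M]
    by (simp add: multispace_dist_def J M multispace_rank_mspan)
qed

text \<open>For comparable multispaces the join is the larger one and the meet the smaller
  one.\<close>

lemma multispace_dist_subseteq:
  fixes A B :: "('a::{field,finite} ^ 'n) multiset"
  assumes "mspan B \<subseteq># mspan A"
  shows "multispace_dist (mspan A) (mspan B) = int (size A) - int (size B)"
proof -
  let ?L = "multispace_poset :: ('a ^ 'n) multiset gorder"
  interpret lattice ?L
    by (rule lattice_multispace_poset)
  have car: "carrier ?L = range mspan" and le: "le ?L = (\<subseteq>#)"
    by (simp_all add: multispace_poset_def multispaces_def)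
  have "mspan A \<squnion>\<^bsub>?L\<^esub> mspan B = mspan A"
    using join_left[of "mspan A" "mspan B"] join_le[of "mspan A" "mspan A" "mspan B"] assms
    by (simp add: car le subset_mset.antisym)
  moreover have "mspan A \<sqinter>\<^bsub>?L\<^esub> mspan B = mspan B"
    using meet_right[of "mspan A" "mspan B"] meet_le[of "mspan B" "mspan A" "mspan B"] assms
    by (simp add: car le subset_mset.antisym)
  ultimately show ?thesis
    by (simp add: multispace_dist_def multispace_rank_mspan)
qed

section \<open>Inclusions between multispans\<close>

text \<open>Prepending a vector sums shifted multiplicities, which preserves pointwise
  inequalities.\<close>

lemma mspan_list_append_mono:
  assumes "mspan_list c \<subseteq># mspan_list b"
  shows "mspan_list (d @ c) \<subseteq># mspan_list (d @ b)"
  by (induction d)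
    (use assms in \<open>auto simp: subseteq_mset_def count_mspan_list_Cons intro!: sum_mono\<close>)

text \<open>In the sum of shifted multiplicities, the summand for the coefficient 0 is already the
  old multiplicity.\<close>

lemma mspan_list_subseteq_append: "mspan_list b \<subseteq># mspan_list (d @ b)"
proof (induction d)
  case (Cons a d)
  have "count (mspan_list (d @ b)) v \<le> count (mspan_list (a # d @ b)) v" for v
    unfolding count_mspan_list_Cons
    using member_le_sum[of 0 UNIV "\<lambda>c. count (mspan_list (d @ b)) (v - c *s a)"] by simp
  with Cons show ?case
    by (auto simp: subseteq_mset_def intro: order_trans)
qed simp

lemma mspan_list_subseteq_inj:
  fixes b c :: "('a::{field,finite} ^ 'n) list"
  assumes "inj_on f {\<alpha>. length \<alpha> = length c}"
    and "\<And>\<alpha>. length \<alpha> = length c \<Longrightarrow> length (f \<alpha>) = length b"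
    and "\<And>\<alpha>. length \<alpha> = length c \<Longrightarrow> tuple_lincomb (f \<alpha>) b = tuple_lincomb \<alpha> c"
  shows "mspan_list c \<subseteq># mspan_list b"
  unfolding subseteq_mset_def count_mspan_list
proof
  fix v
  show "card {\<alpha>. length \<alpha> = length c \<and> tuple_lincomb \<alpha> c = v}
      \<le> card {\<beta>. length \<beta> = length b \<and> tuple_lincomb \<beta> b = v}"
    by (rule card_inj_on_le[where f = f])
      (use assms in \<open>auto intro: inj_on_subset finite_subset[OF _ finite_tuples]\<close>)
qed

section \<open>Independent columns of a matrix\<close>

text \<open>A maximal independent set of columns has \<open>rank A\<close> elements. Indices are
  chosen instead of columns because equal columns of \<open>T\<close> give separate entries of
  \<open>b T\<close>.\<close>

lemma (in vec_space) rank_columns: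
  assumes A: "A \<in> carrier_mat n nc"
  obtains J where "distinct J" "set J \<subseteq> {..<nc}" "length J = rank A"
    and "distinct (map (col A) J)" "lin_indpt (set (map (col A) J))"
proof -
  have "lin_indpt {}"
    by (simp add: lin_dep_def)
  then have "\<exists>S. finite S \<and> maximal S (\<lambda>U. U \<subseteq> set (cols A) \<and> lin_indpt U) \<and> {} \<subseteq> S"
    by (intro maximal_exists_superset[of "set (cols A)"]) simp_all
  then obtain S where S: "maximal S (\<lambda>U. U \<subseteq> set (cols A) \<and> lin_indpt U)"
    by blast
  then have sub: "S \<subseteq> set (cols A)" and ind: "lin_indpt S"
    by (metis maximal_def)+
  have "set (cols A) = col A ` {..<nc}"
    using A by (simp add: cols_def atLeast0LessThan)
  then have sub: "S \<subseteq> col A ` {..<nc}"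
    using sub by blast
  \<comment> \<open>One index is picked for each column in \<open>S\<close>.\<close>
  obtain I where I: "I \<subseteq> {..<nc}" "S = col A ` I" "inj_on (col A) I"
    using sub by (metis subset_image_inj)
  obtain J where J: "set J = I" "distinct J"
    using finite_distinct_list[of I] I(1) finite_subset by blast
  have "card I = rank A"
    using rank_card_indpt[OF A S] I by (simp add: card_image)
  then have "length J = rank A"
    using distinct_card[OF J(2)] unfolding J(1) by simp
  moreover have "distinct (map (col A) J)"
    unfolding distinct_map J(1) using J(2) I(3) by (rule conjI)
  moreover have "set (map (col A) J) = S"
    by (simp only: set_map J(1) I(2))
  ultimately show ?thesis
    using that[of J] I(1) J ind by metis
qed

text \<open>A nonzero kernel vector would be a linear dependency among the columns.\<close>

lemma (in vec_space) mult_mat_vec_inj_on: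
  assumes A: "A \<in> carrier_mat n nc" and "distinct (cols A)" "lin_indpt (set (cols A))"
  shows "inj_on ((*\<^sub>v) A) (carrier_vec nc)"
proof (rule inj_onI)
  fix x y
  assume x: "x \<in> carrier_vec nc" and y: "y \<in> carrier_vec nc" and "A *\<^sub>v x = A *\<^sub>v y"
  then have "A *\<^sub>v (x - y) = 0\<^sub>v n"
    using A by (simp add: mult_minus_distrib_mat_vec)
  then have 0: "x - y = 0\<^sub>v nc"
    using lin_depI[OF A, of "x - y"] x y assms by auto
  show "x = y"
  proof (rule eq_vecI)
    fix i
    assume "i < dim_vec y"
    then show "x $ i = y $ i"
      using arg_cong[OF 0, of "\<lambda>v. v $ i"] carrier_vecD[OF y] by simp
  qed (simp only: carrier_vecD[OF x] carrier_vecD[OF y])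
qed

lemma vec_of_list_carrier: "vec_of_list x \<in> carrier_vec n \<longleftrightarrow> length x = n"
  by (metis carrier_vecD carrier_vecI dim_vec_of_list)
lemma inj_on_list_mult:
  fixes A :: "'a::field mat"
  assumes inj: "inj_on ((*\<^sub>v) A) (carrier_vec k)"
  shows "inj_on (\<lambda>\<alpha>. list_of_vec (A *\<^sub>v vec_of_list \<alpha>)) {\<alpha>. length \<alpha> = k}"
proof (rule inj_onI)
  fix x y :: "'a list"
  assume xy: "x \<in> {\<alpha>. length \<alpha> = k}" "y \<in> {\<alpha>. length \<alpha> = k}"
    and "list_of_vec (A *\<^sub>v vec_of_list x) = list_of_vec (A *\<^sub>v vec_of_list y)"
  then have "A *\<^sub>v vec_of_list x = A *\<^sub>v vec_of_list y"
    by (metis vec_list)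
  then have "vec_of_list x = vec_of_list y"
    using inj xy by (simp add: inj_on_def vec_of_list_carrier)
  then show "x = y"
    by (metis list_vec)
qed

text \<open>Let \<open>A\<close> consist of the columns in \<open>J\<close>. Then
  \<open>\<alpha> \<mapsto> A \<alpha>\<close> is injective, and exchanging two sums shows that
  \<open>A \<alpha>\<close> over \<open>b\<close> represents the same vector as
  \<open>\<alpha>\<close> over the chosen entries of \<open>b T\<close>.\<close>

lemma mspan_list_indpt_columns:
  fixes b :: "('a::{field,finite} ^ 'n) list"
  assumes T: "T \<in> carrier_mat (length b) m'" and J: "set J \<subseteq> {..<m'}"
    and dist: "distinct (map (col T) J)"
    and ind: "\<not> module.lin_dep class_ring (module_vec TYPE('a) (length b)) (set (map (col T) J))"
  shows "mspan_list (map ((!) (row_times_mat b T)) J) \<subseteq># mspan_list b"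
proof -
  let ?A = "mat_of_cols (length b) (map (col T) J)"
  let ?f = "\<lambda>\<alpha>. list_of_vec (?A *\<^sub>v vec_of_list \<alpha>)"
  have A: "?A \<in> carrier_mat (length b) (length J)"
    using mat_of_cols_carrier(1)[of "length b" "map (col T) J"] by simp
  have cols: "cols ?A = map (col T) J"
    using T J by (intro cols_mat_of_cols) (auto simp: subset_eq)
  have inj: "inj_on ((*\<^sub>v) ?A) (carrier_vec (length J))"
    by (rule vec_space.mult_mat_vec_inj_on[OF A]) (simp_all only: cols dist ind not_False_eq_True)
  show ?thesis
  proof (rule mspan_list_subseteq_inj[where f = ?f])
    show "inj_on ?f {\<alpha>. length \<alpha> = length (map ((!) (row_times_mat b T)) J)}"
      using inj_on_list_mult[OF inj] by (simp only: length_map)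
  next
    fix \<alpha> :: "'a list"
    assume "length \<alpha> = length (map ((!) (row_times_mat b T)) J)"
    then have \<alpha>: "length \<alpha> = length J"
      by simp
    show "length (?f \<alpha>) = length b"
      by simp
    have f: "?f \<alpha> ! i = (\<Sum>j<length J. T $$ (i, J ! j) * \<alpha> ! j)" if "i < length b" for i
    proof -
      have "?f \<alpha> ! i = (\<Sum>j<length J. ?A $$ (i, j) * \<alpha> ! j)"
        using that \<alpha> by (simp add: list_of_vec_index scalar_prod_def vec_of_list_index
            atLeast0LessThan)
      also have "\<dots> = (\<Sum>j<length J. T $$ (i, J ! j) * \<alpha> ! j)"
        using that T J by (intro sum.cong) (auto simp: mat_of_cols_index subset_eq)
      finally show ?thesis .
    qed
    have "tuple_lincomb (?f \<alpha>) b
        = (\<Sum>i<length b. \<Sum>j<length J. (\<alpha> ! j * T $$ (i, J ! j)) *s b ! i)"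
      unfolding tuple_lincomb_def
      by (intro sum.cong refl, simp only: lessThan_iff f)
        (simp add: vec.scale_sum_left mult.commute)
    also have "\<dots> = (\<Sum>j<length J. \<alpha> ! j *s (\<Sum>i<length b. T $$ (i, J ! j) *s b ! i))"
      by (subst sum.swap) (simp add: vec.scale_sum_right)
    also have "\<dots> = tuple_lincomb \<alpha> (map ((!) (row_times_mat b T)) J)"
      unfolding tuple_lincomb_def
      using T J by (intro sum.cong) (auto simp: row_times_mat_def subset_eq)
    finally show "tuple_lincomb (?f \<alpha>) b = tuple_lincomb \<alpha> (map ((!) (row_times_mat b T)) J)" .
  qed
qed

section \<open>Splitting the transformed tuple, and the two estimates\<close>

text \<open>The entries of \<open>b T\<close> at independent columns form \<open>c\<close>, all
  others \<open>d\<close>. Equality up to order is enough, since a multispan depends only on the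
  multiset of its generators.\<close>

lemma mset_row_times_mat_split:
  fixes b :: "('a::{field,finite} ^ 'n) list"
  assumes T: "T \<in> carrier_mat (length b) m'"
  obtains c d where "mset (row_times_mat b T) = mset (d @ c)" "length c = mat_rank T"
    and "mspan_list c \<subseteq># mspan_list b"
proof -
  interpret vec_space "TYPE('a)" "length b" .
  obtain J where J: "distinct J" "set J \<subseteq> {..<m'}" "length J = rank T"
    "distinct (map (col T) J)" "lin_indpt (set (map (col T) J))"
    using rank_columns[OF T] .
  let ?g = "(!) (row_times_mat b T)"
  let ?K = "filter (\<lambda>j. j \<notin> set J) [0..<m']"
  have len: "length (row_times_mat b T) = m'"
    using T by (simp add: row_times_mat_def)
  have "mset (?K @ J) = mset [0..<m']"
    using J by (subst set_eq_iff_mset_eq_distinct[symmetric]) auto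
  then have "mset (map ?g (?K @ J)) = mset (map ?g [0..<m'])"
    by (simp only: mset_map)
  also have "map ?g [0..<m'] = row_times_mat b T"
    using len map_nth by blast
  finally show ?thesis
    using that[of "map ?g ?K" "map ?g J"] J T mspan_list_indpt_columns[OF T J(2,4,5)] by simp
qed

theorem proposition3p1:
  fixes b b' :: "('a::{field,finite} ^ 'n) list"
    and T :: "'a mat"
    and m m' s :: nat
  assumes "length b = m"
    and "length b' = m'"
    and "T \<in> carrier_mat m m'"
    and "b' = row_times_mat b T"
  shows "(s \<le> m \<and> m' = m - s \<and> mat_rank T = m'
        \<longrightarrow> multispace_dist (mspan (mset b)) (mspan (mset b')) = int s)
    \<and> (s \<le> m \<and> m' = m \<and> mat_rank T = m - s
        \<longrightarrow> multispace_dist (mspan (mset b)) (mspan (mset b')) \<le> 2 * int s)"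
proof -
  obtain c d where b': "mset b' = mset (d @ c)" and c: "length c = mat_rank T"
    and cb: "mspan_list c \<subseteq># mspan_list b"
    using mset_row_times_mat_split[of T b m'] assms(1,3) unfolding assms(4) by blast
  have m': "m' = length d + mat_rank T"
    using b' c assms(2) by (metis length_append size_mset)
  have 1: "multispace_dist (mspan (mset b)) (mspan (mset b')) = int s"
    if "s \<le> m" "m' = m - s" "mat_rank T = m'"
  proof -
    \<comment> \<open>At full column rank \<open>c\<close> already accounts for all
      \<open>m'\<close> entries of \<open>b'\<close>.\<close>
    have "d = []"
      using m' that by (metis add_cancel_left_left length_0_conv)
    then have "multispace_dist (mspan (mset b)) (mspan (mset b')) = int (length b) - int (length c)"
      using multispace_dist_subseteq[of "mset c" "mset b"] cb b' by (simp add: mspan_mset)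
    then show ?thesis
      using assms(1) c that by simp
  qed
  have 2: "multispace_dist (mspan (mset b)) (mspan (mset b')) \<le> 2 * int s"
    if "s \<le> m" "m' = m" "mat_rank T = m - s"
  proof -
    \<comment> \<open>Here \<open>d\<close> has length \<open>s\<close>, so the common lower bound
      from \<open>c\<close> has \<open>m - s\<close> generators and the common upper bound from
      \<open>d @ b\<close> has \<open>m + s\<close>.\<close>
    have "multispace_dist (mspan (mset b)) (mspan (mset (d @ c)))
        \<le> int (size (mset (d @ b))) - int (size (mset c))"
      by (rule multispace_dist_le)
        (simp_all only: mspan_mset cb mspan_list_subseteq_append mspan_list_append_mono)
    then show ?thesis
      using b' assms(1) c m' that by simp
  qed
  show ?thesis
    using 1 2 by blast
qed

end
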